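(* Let $K>0$ be fixed, and for each $n$ let $n_1<n_2$ be positive integers with $n_2\le n\le Kn_1$. Let $\hat f_2$ be the corresponding general $2$-jackknife estimator. Then: 1. if $f(p)=-p\ln p$, then $\|\mathbb{E}_p\hat f_2-f(p)\|\lesssim\frac1n$; 2. if $f(p)=p^\alpha$ with $0<\alpha<1$, then $\|\mathbb{E}_p\hat f_2-f(p)\|\lesssim_\alpha\frac1{n^\alpha}$. Moreover, let $\hat f_2$ be either the delete-$1$ $2$-jackknife ($n_1=n-1$, $n_2=n$), or a $2$-jackknife satisfying the bounded coefficients condition $|C_1|+|C_2|\le C$ for a constant $C$ not depending on $n$. Then: 1. if $f(p)=-p\ln p$, then $\|\mathbb{E}_p\hat f_2-f(p)\|\gtrsim\frac1n$; 2. if $f(p)=p^\alpha$ with $0<\alpha<1$, then $\|\mathbb{E}_p\hat f_2-f(p)\|\gtrsim_\alpha\frac1{n^\alpha}$.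
   Context: All norms are supremum norms over $p\in[0,1]$; $0\ln0=0$. The general $2$-jackknife estimator is $\hat f_2=C_1\mathbb{U}_{n,1}+C_2\mathbb{U}_{n,2}$ with $C_1=\frac{n_1}{n_1-n_2}$, $C_2=\frac{n_2}{n_2-n_1}$, where $\mathbb{U}_{n,i}$ is the average of $f\big(\frac1{n_i}\sum_{k\in S}X_k\big)$ over all subsets $S\subset\{1,\dots,n\}$ of size $n_i$, and $X_1,\dots,X_n$ are i.i.d. $\mathrm{Bernoulli}(p)$. Thus $\mathbb{E}_p\hat f_2=C_1\mathbb{E}_pf(\hat p_{n_1})+C_2\mathbb{E}_pf(\hat p_{n_2})$, where $m\hat p_m\sim\mathrm{Binomial}(m,p)$. $a\lesssim_\theta b$ means $a\le Mb$ for all $n$ with a constant $M>0$ depending only on $\theta$ (no subscript: absolute constant); $a\gtrsim_\theta b$ means $b\lesssim_\theta a$. The constants $K$ and $C$ are fixed, and the implied constants may also depend on them. *)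

theory Defs
  imports "HOL-Probability.Probability"
begin

text \<open>A sample of size n is a function on the index set {1..n} (the indices outside get a dummy
  value); the observation \<open>X\<^sub>k\<close> is \<open>of_bool (x k)\<close>.\<close>

definition iid_bernoulli :: "nat \<Rightarrow> real \<Rightarrow> (nat \<Rightarrow> bool) pmf" where
  "iid_bernoulli n p = Pi_pmf {1..n} False (\<lambda>_. bernoulli_pmf p)"

definition U_stat :: "(real \<Rightarrow> real) \<Rightarrow> nat \<Rightarrow> nat \<Rightarrow> (nat \<Rightarrow> bool) \<Rightarrow> real" where
  "U_stat f n m x =
     (\<Sum>S | S \<subseteq> {1..n} \<and> card S = m. f ((\<Sum>k\<in>S. of_bool (x k)) / real m)) / real (n choose m)"

definition coeff1 :: "nat \<Rightarrow> nat \<Rightarrow> real" where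
  "coeff1 n1 n2 = real n1 / (real n1 - real n2)"

definition coeff2 :: "nat \<Rightarrow> nat \<Rightarrow> real" where
  "coeff2 n1 n2 = real n2 / (real n2 - real n1)"

definition jackknife2 :: "(real \<Rightarrow> real) \<Rightarrow> nat \<Rightarrow> nat \<Rightarrow> nat \<Rightarrow> (nat \<Rightarrow> bool) \<Rightarrow> real" where
  "jackknife2 f n n1 n2 x = coeff1 n1 n2 * U_stat f n n1 x + coeff2 n1 n2 * U_stat f n n2 x"

definition jackknife2_bias :: "(real \<Rightarrow> real) \<Rightarrow> nat \<Rightarrow> nat \<Rightarrow> nat \<Rightarrow> real \<Rightarrow> real" where
  "jackknife2_bias f n n1 n2 p =
     measure_pmf.expectation (iid_bernoulli n p) (jackknife2 f n n1 n2) - f p"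

text \<open>Real-valued supremum: meaningful only for functions that are bounded on the unit interval,
  as \<open>jackknife2_bias f n n1 n2\<close> is whenever f is bounded there.\<close>

definition sup_norm :: "(real \<Rightarrow> real) \<Rightarrow> real" where
  "sup_norm g = (SUP p\<in>{0..1}. \<bar>g p\<bar>)"

definition admissible :: "real \<Rightarrow> nat \<Rightarrow> nat \<Rightarrow> nat \<Rightarrow> bool" where
  "admissible K n n1 n2 \<longleftrightarrow> 0 < n1 \<and> n1 < n2 \<and> n2 \<le> n \<and> real n \<le> K * real n1"

definition delete_one :: "nat \<Rightarrow> nat \<Rightarrow> nat \<Rightarrow> bool" where
  "delete_one n n1 n2 \<longleftrightarrow> n \<ge> 2 \<and> n1 = n - 1 \<and> n2 = n"

definition bounded_coeffs :: "real \<Rightarrow> nat \<Rightarrow> nat \<Rightarrow> bool" where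
  "bounded_coeffs C n1 n2 \<longleftrightarrow> \<bar>coeff1 n1 n2\<bar> + \<bar>coeff2 n1 n2\<bar> \<le> C"

text \<open>The convention \<open>0 ln 0 = 0\<close> holds since \<open>0 * ln 0 = 0\<close>.\<close>

definition neg_p_ln_p :: "real \<Rightarrow> real" where
  "neg_p_ln_p p = - p * ln p"

end

theory Submission
  imports Defs
begin

text \<open>
  Write \<open>B\<^sub>m f\<close> for the Bernstein polynomial \<open>p \<mapsto> E f(X\<^sub>m/m)\<close>, with \<open>X\<^sub>m\<close> binomial. The bias of the
  2-jackknife is the average over \<open>n1 \<le> m < n2\<close> of \<open>(m+1) B\<^sub>m\<^sub>+\<^sub>1 f - m B\<^sub>m f - f\<close>, so the upper bounds
  reduce to the delete-1 case.

  Put \<open>N = m + 1\<close>. Deleting one of N observations turns a success fraction \<open>x = k/N\<close> into \<open>(k-1)/m\<close>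
  with probability x and into \<open>k/m\<close> with probability \<open>1 - x\<close>, a two-point law with mean x and
  variance \<open>x(1-x)/m\<^sup>2\<close>. Both functions have the form \<open>f(x) = x h(x)\<close> with f concave and h convex and
  decreasing, and then a law with mean \<open>\<mu>\<close> satisfies \<open>0 \<le> f(\<mu>) - E f \<le> -h'(\<mu>) Var\<close>. Applied to the
  two-point law and to the binomial law this bounds every summand by the claimed rate.

  For the lower bounds take \<open>p = \<epsilon>/n\<close>: the expectation of the estimator is then at most
  \<open>p h(1/n)\<close> plus p times n times the rate, while \<open>f(p) = p h(\<epsilon>/n)\<close> is larger by a fixed multiple of
  the rate.
\<close>

section \<open>The bias as an average of delete-1 biases\<close>

definition bernstein_op :: "(real \<Rightarrow> real) \<Rightarrow> nat \<Rightarrow> real \<Rightarrow> real" where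
  "bernstein_op f m p = (\<Sum>k\<le>m. Bernstein m k p * f (real k / real m))"

text \<open>Indexed by the smaller subset size: for m >= 1 this is the bias of the delete-1
  estimator on m + 1 observations, whose coefficients are - m and m + 1.\<close>

definition delete_one_bias :: "(real \<Rightarrow> real) \<Rightarrow> nat \<Rightarrow> real \<Rightarrow> real" where
  "delete_one_bias f m p =
     real (Suc m) * bernstein_op f (Suc m) p - real m * bernstein_op f m p - f p"

section \<open>Expectations of the U-statistics\<close>

lemma finite_set_pmf_iid_bernoulli: "finite (set_pmf (iid_bernoulli n p))"
  unfolding iid_bernoulli_def
  by (rule finite_subset[OF set_Pi_pmf_subset']) auto

text \<open>The success count in S depends only on the coordinates in S, whose marginal law is again
  a product of Bernoulli laws; the count is therefore binomial.\<close>

lemma expectation_subset_mean: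
  assumes "p \<in> {0..1}" "S \<subseteq> {1..n}" "card S = m"
  shows "measure_pmf.expectation (iid_bernoulli n p) (\<lambda>x. f ((\<Sum>k\<in>S. of_bool (x k)) / real m))
         = bernstein_op f m p"
proof -
  have fin: "finite S"
    using assms(2) finite_subset by blast
  have count: "(\<Sum>k\<in>S. of_bool (x k)) = real (card {k \<in> S. x k})" for x :: "nat \<Rightarrow> bool"
    using fin by (simp add: of_bool_def sum.If_cases Int_def)
  have "binomial_pmf m p =
      map_pmf (\<lambda>x. card {k \<in> S. x k}) (Pi_pmf S False (\<lambda>_. bernoulli_pmf p))"
    by (rule binomial_pmf_altdef') (use assms fin in auto)
  also have "\<dots> = map_pmf (\<lambda>x. card {k \<in> S. x k}) (iid_bernoulli n p)"
    unfolding iid_bernoulli_def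
    by (subst Pi_pmf_subset[of "{1..n}" S])
      (use assms(2) in \<open>auto simp: pmf.map_comp o_def intro!: map_pmf_cong arg_cong[where f = card]\<close>)
  finally have "measure_pmf.expectation (binomial_pmf m p) (\<lambda>k. f (real k / real m))
      = measure_pmf.expectation (iid_bernoulli n p) (\<lambda>x. f (real (card {k \<in> S. x k}) / real m))"
    by simp
  then show ?thesis
    using assms(1) by (simp add: count expectation_binomial_pmf' bernstein_op_def Bernstein_def)
qed

lemma expectation_U_stat:
  assumes "p \<in> {0..1}" "m \<le> n"
  shows "measure_pmf.expectation (iid_bernoulli n p) (U_stat f n m) = bernstein_op f m p"
proof -
  let ?\<S> = "{S. S \<subseteq> {1..n} \<and> card S = m}"
  have card: "card ?\<S> = n choose m"
    using n_subsets[of "{1..n}" m] by simp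
  have "measure_pmf.expectation (iid_bernoulli n p) (U_stat f n m)
      = (\<Sum>S\<in>?\<S>. measure_pmf.expectation (iid_bernoulli n p)
            (\<lambda>x. f ((\<Sum>k\<in>S. of_bool (x k)) / real m))) / real (n choose m)"
    unfolding U_stat_def
    by (simp add: Bochner_Integration.integral_sum integrable_measure_pmf_finite
        finite_set_pmf_iid_bernoulli)
  also have "\<dots> = (\<Sum>S\<in>?\<S>. bernstein_op f m p) / real (n choose m)"
    using assms(1) by (intro arg_cong2[where f = "(/)"] sum.cong refl expectation_subset_mean) auto
  also have "\<dots> = bernstein_op f m p"
    unfolding sum_constant card using assms(2) by simp
  finally show ?thesis .
qed

text \<open>Since the two coefficients sum to 1, the bias is a difference quotient of
  \<open>?E\<close> between n1 and n2. Telescoping finishes, because the unit increments of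
  \<open>?E\<close> are the delete-1 biases.\<close>

lemma jackknife2_bias_eq:
  assumes "p \<in> {0..1}" "n1 < n2" "n2 \<le> n"
  shows "jackknife2_bias f n n1 n2 p =
    (\<Sum>m = n1..<n2. delete_one_bias f m p) / (real n2 - real n1)"
proof -
  let ?E = "\<lambda>m. real m * (bernstein_op f m p - f p)"
  have "jackknife2_bias f n n1 n2 p =
      coeff1 n1 n2 * bernstein_op f n1 p + coeff2 n1 n2 * bernstein_op f n2 p - f p"
    unfolding jackknife2_bias_def jackknife2_def
    using assms
    by (simp add: integrable_measure_pmf_finite finite_set_pmf_iid_bernoulli expectation_U_stat)
  also have "\<dots> = (?E n2 - ?E n1) / (real n2 - real n1)"
    using assms by (simp add: coeff1_def coeff2_def divide_simps) (simp add: algebra_simps)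
  also have "?E n2 - ?E n1 = (\<Sum>m = n1..<n2. ?E (Suc m) - ?E m)"
    using assms by (subst sum_Suc_diff') auto
  also have "\<dots> = (\<Sum>m = n1..<n2. delete_one_bias f m p)"
    by (intro sum.cong) (auto simp: delete_one_bias_def algebra_simps)
  finally show ?thesis .
qed

text \<open>Dropping a uniformly chosen observation from m + 1 leaves an i.i.d. sample of size m;
  given k successes, the dropped one is a success with probability k/(m + 1). \<open>succ\<close>
  and \<open>same\<close> are the binomial absorption identities behind this.\<close>

lemma bernstein_op_downward:
  assumes "1 \<le> m"
  shows "bernstein_op f m p = (\<Sum>k\<le>Suc m. Bernstein (Suc m) k p *
    (real k / real (Suc m) * f ((real k - 1) / real m)
      + (1 - real k / real (Suc m)) * f (real k / real m)))"
proof -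
  let ?N = "Suc m"
  have succ: "Bernstein ?N (Suc k) p * (real (Suc k) / real ?N) = p * Bernstein m k p" for k
  proof -
    have "real (?N choose Suc k) * real (Suc k) = real ?N * real (m choose k)"
      using Suc_times_binomial_eq[of m k] by (simp only: of_nat_mult[symmetric])
    then have *: "real (m choose k) = real (?N choose Suc k) * (real (Suc k) / real ?N)"
      by (simp add: field_simps del: of_nat_Suc binomial_Suc_Suc)
    show ?thesis
      unfolding Bernstein_def * by (simp add: mult_ac del: of_nat_Suc binomial_Suc_Suc)
  qed
  have same: "Bernstein ?N k p * (1 - real k / real ?N) = (1 - p) * Bernstein m k p"
    if "k \<le> m" for k
  proof -
    have "real (?N - k) * real (?N choose k) = real ?N * real (m choose k)"
      using binomial_absorb_comp[of ?N k] by (simp only: of_nat_mult[symmetric] diff_Suc_1)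
    moreover have "real (?N - k) = real ?N - real k"
      using that by (simp add: of_nat_diff)
    ultimately have "real (?N choose k) * (1 - real k / real ?N) = real (m choose k)"
      by (simp add: field_simps del: of_nat_Suc)
    moreover have "(1 - p) ^ (?N - k) = (1 - p) * (1 - p) ^ (m - k)"
      using that by (simp add: Suc_diff_le)
    ultimately show ?thesis
      by (simp add: Bernstein_def mult_ac del: of_nat_Suc)
  qed
  have "(\<Sum>k\<le>?N. Bernstein ?N k p * (real k / real ?N) * f ((real k - 1) / real m))
      = p * bernstein_op f m p"
    \<comment> \<open>The term k = 0, where f is evaluated at -1/m, has weight 0.\<close>
    by (subst sum.atMost_Suc_shift) (simp only: succ bernstein_op_def sum_distrib_left, simp add: mult_ac)
  moreover have "(\<Sum>k\<le>?N. Bernstein ?N k p * (1 - real k / real ?N) * f (real k / real m))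
      = (1 - p) * bernstein_op f m p"
  proof -
    \<comment> \<open>Here the top term k = m + 1 has weight 0.\<close>
    have "(\<Sum>k\<le>?N. Bernstein ?N k p * (1 - real k / real ?N) * f (real k / real m))
        = (\<Sum>k\<le>m. Bernstein ?N k p * (1 - real k / real ?N) * f (real k / real m))"
      by simp
    also have "\<dots> = (\<Sum>k\<le>m. (1 - p) * Bernstein m k p * f (real k / real m))"
      by (intro sum.cong refl) (simp only: same atMost_iff)
    finally show ?thesis
      by (simp add: bernstein_op_def sum_distrib_left mult_ac)
  qed
  ultimately show ?thesis
    by (simp add: distrib_left sum.distrib mult.assoc[symmetric] del: sum.atMost_Suc)
      (simp add: algebra_simps)
qed

text \<open>Of the m + 1 copies of the larger Bernstein polynomial, m are paired with those of the
  smaller one and the last with f. For concave f the first part is nonnegative and the second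
  nonpositive.\<close>

lemma delete_one_bias_eq:
  assumes "1 \<le> m"
  shows "delete_one_bias f m p = (\<Sum>k\<le>Suc m. Bernstein (Suc m) k p *
      (real m * (f (real k / real (Suc m)) - (real k / real (Suc m) * f ((real k - 1) / real m)
         + (1 - real k / real (Suc m)) * f (real k / real m)))))
      + (bernstein_op f (Suc m) p - f p)"
proof -
  have "real (Suc m) * bernstein_op f (Suc m) p =
      real m * bernstein_op f (Suc m) p + bernstein_op f (Suc m) p"
    by (simp add: algebra_simps)
  then show ?thesis
    unfolding delete_one_bias_def bernstein_op_downward[OF assms]
    by (simp only: bernstein_op_def sum_distrib_left right_diff_distrib sum_subtractf)
      (simp add: mult_ac del: sum.atMost_Suc of_nat_Suc)
qed

section \<open>Moments of the binomial proportion\<close>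

lemma bernstein_op_square: "1 \<le> n \<Longrightarrow> bernstein_op (\<lambda>x. x\<^sup>2) n p = p\<^sup>2 + p * (1 - p) / real n"
proof -
  assume n: "1 \<le> n"
  have "(\<Sum>k\<le>n. Bernstein n k p * (real k)\<^sup>2)
      = (\<Sum>k\<le>n. real k * (real k - 1) * Bernstein n k p) + (\<Sum>k\<le>n. real k * Bernstein n k p)"
    unfolding sum.distrib[symmetric]
    by (intro sum.cong refl) (simp add: algebra_simps power2_eq_square)
  also have "\<dots> = real n * (real n - 1) * p\<^sup>2 + real n * p"
    by simp
  finally have "(\<Sum>k\<le>n. Bernstein n k p * (real k)\<^sup>2) / (real n)\<^sup>2
      = (real n * (real n - 1) * p\<^sup>2 + real n * p) / (real n)\<^sup>2"
    by simp
  with n show ?thesis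
    by (simp add: bernstein_op_def power_divide sum_divide_distrib)
      (simp add: field_simps power2_eq_square)
qed

lemma bernstein_op_ident: "1 \<le> n \<Longrightarrow> bernstein_op (\<lambda>x. x) n p = p"
proof -
  assume n: "1 \<le> n"
  have "bernstein_op (\<lambda>x. x) n p = (\<Sum>k\<le>n. real k * Bernstein n k p) / real n"
    unfolding bernstein_op_def sum_divide_distrib by (intro sum.cong) auto
  also have "\<dots> = p"
    using n by (simp only: sum_k_Bernstein) simp
  finally show ?thesis .
qed

section \<open>Concave functions of the form \<open>x h(x)\<close>\<close>

text \<open>Here c is the slope of f, d is the negated slope of h, and r is the rate of the bias. The first
  alternative in \<open>rate\<close> fails for \<open>x\<^sup>\<alpha>\<close> when x is small; there f itself is below the rate.\<close>

locale concave_profile =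
  fixes f h c d :: "real \<Rightarrow> real" and r :: "nat \<Rightarrow> real" and \<epsilon> :: real
  assumes f_zero: "f 0 = 0"
    and f_eq: "0 < x \<Longrightarrow> f x = x * h x"
    and f_tangent: "0 < \<mu> \<Longrightarrow> 0 \<le> x \<Longrightarrow> f x \<le> f \<mu> + c \<mu> * (x - \<mu>)"
    and h_tangent: "0 < \<mu> \<Longrightarrow> 0 < x \<Longrightarrow> h \<mu> - d \<mu> * (x - \<mu>) \<le> h x"
    and d_nonneg: "0 < \<mu> \<Longrightarrow> 0 \<le> d \<mu>"
    and h_one_nonneg: "0 \<le> h 1"
    and r_nonneg: "0 \<le> r N"
    and r_antimono: "1 \<le> m \<Longrightarrow> m \<le> N \<Longrightarrow> r N \<le> r m"
    and scaled_r_mono: "1 \<le> m \<Longrightarrow> m \<le> N \<Longrightarrow> real m * r m \<le> real N * r N"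
    and rate: "1 \<le> N \<Longrightarrow> 0 < x \<Longrightarrow> x \<le> 1 \<Longrightarrow>
      x * d x \<le> real N * r N \<or> real N * x < 1 \<and> f x \<le> r N"
    and eps: "0 < \<epsilon>" "\<epsilon> \<le> 1"
    and h_gap: "1 \<le> N \<Longrightarrow> h (1 / real N) + 3 * (real N * r N) \<le> h (\<epsilon> / real N)"
begin

lemma h_antimono: "0 < x \<Longrightarrow> x \<le> y \<Longrightarrow> h y \<le> h x"
  using h_tangent[of y x] d_nonneg[of y] mult_nonneg_nonpos[of "d y" "x - y"] by simp

lemma f_nonneg: "0 \<le> x \<Longrightarrow> x \<le> 1 \<Longrightarrow> 0 \<le> f x"
  using h_antimono[of x 1] h_one_nonneg f_eq[of x] f_zero by (cases "x = 0") auto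

text \<open>The first bound averages the tangent of f at \<mu>. For the second, x times the tangent
  of h at \<mu> is a quadratic minorant of f touching it at \<mu>, and the quadratic part averages
  to the variance times - d \<mu>.\<close>

lemma jensen_gap:
  assumes w: "\<And>i. i \<in> I \<Longrightarrow> 0 \<le> w i" "(\<Sum>i\<in>I. w i) = 1"
    and y: "\<And>i. i \<in> I \<Longrightarrow> 0 \<le> y i" "(\<Sum>i\<in>I. w i * y i) = \<mu>" "0 < \<mu>"
  shows "(\<Sum>i\<in>I. w i * f (y i)) \<le> f \<mu>"
    and "f \<mu> - (\<Sum>i\<in>I. w i * f (y i)) \<le> d \<mu> * ((\<Sum>i\<in>I. w i * (y i)\<^sup>2) - \<mu>\<^sup>2)"
proof -
  have "(\<Sum>i\<in>I. w i * f (y i)) \<le> (\<Sum>i\<in>I. w i * (f \<mu> + c \<mu> * (y i - \<mu>)))"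
    using w(1) y(1,3) by (intro sum_mono mult_left_mono f_tangent) auto
  also have "\<dots> = (\<Sum>i\<in>I. f \<mu> * w i + c \<mu> * (w i * y i) - c \<mu> * \<mu> * w i)"
    by (simp add: algebra_simps)
  also have "\<dots> = f \<mu> * (\<Sum>i\<in>I. w i) + c \<mu> * (\<Sum>i\<in>I. w i * y i) - c \<mu> * \<mu> * (\<Sum>i\<in>I. w i)"
    by (simp only: sum.distrib sum_subtractf sum_distrib_left)
  also have "\<dots> = f \<mu>"
    using w y by simp
  finally show "(\<Sum>i\<in>I. w i * f (y i)) \<le> f \<mu>" .
  \<comment> \<open>At x = 0 both sides vanish, so the minorant extends to 0 although the tangent of
    h is only available for x > 0.\<close>
  have lower: "x * (h \<mu> - d \<mu> * (x - \<mu>)) \<le> f x" if "0 \<le> x" for x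
  proof (cases "x = 0")
    case False
    with that have "0 < x"
      by simp
    then show ?thesis
      using h_tangent[of \<mu> x] y(3) by (simp add: f_eq mult_left_mono)
  qed (simp add: f_zero)
  have "f \<mu> - d \<mu> * ((\<Sum>i\<in>I. w i * (y i)\<^sup>2) - \<mu>\<^sup>2)
      = (h \<mu> + d \<mu> * \<mu>) * (\<Sum>i\<in>I. w i * y i) - d \<mu> * (\<Sum>i\<in>I. w i * (y i)\<^sup>2)"
    using y by (simp add: f_eq algebra_simps power2_eq_square)
  also have "\<dots> = (\<Sum>i\<in>I. (h \<mu> + d \<mu> * \<mu>) * (w i * y i) - d \<mu> * (w i * (y i)\<^sup>2))"
    by (simp only: sum_subtractf sum_distrib_left)
  also have "\<dots> = (\<Sum>i\<in>I. w i * (y i * (h \<mu> - d \<mu> * (y i - \<mu>))))"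
    by (intro sum.cong refl) (simp add: algebra_simps power2_eq_square)
  also have "\<dots> \<le> (\<Sum>i\<in>I. w i * f (y i))"
    using w(1) y(1) by (intro sum_mono mult_left_mono lower) auto
  finally show "f \<mu> - (\<Sum>i\<in>I. w i * f (y i)) \<le> d \<mu> * ((\<Sum>i\<in>I. w i * (y i)\<^sup>2) - \<mu>\<^sup>2)"
    by simp
qed

lemma bernstein_op_nonneg: "0 \<le> p \<Longrightarrow> p \<le> 1 \<Longrightarrow> 0 \<le> bernstein_op f N p"
  unfolding bernstein_op_def
  by (intro sum_nonneg mult_nonneg_nonneg Bernstein_nonneg f_nonneg) (auto simp: divide_le_eq_1)

lemma bernstein_op_error:
  assumes "1 \<le> N" "0 \<le> p" "p \<le> 1"
  shows "bernstein_op f N p \<le> f p" and "f p - bernstein_op f N p \<le> r N"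
proof -
  have "bernstein_op f N p \<le> f p \<and> f p - bernstein_op f N p \<le> r N"
  proof (cases "p = 0")
    case True
    then have "bernstein_op f N p = 0"
      by (auto simp: bernstein_op_def Bernstein_def f_zero power_0_left intro!: sum.neutral)
    with True show ?thesis
      by (simp add: f_zero r_nonneg)
  next
    case False
    with assms have p: "0 < p"
      by simp
    have mean: "(\<Sum>k\<le>N. Bernstein N k p * (real k / real N)) = p"
      using bernstein_op_ident[OF assms(1), of p] by (simp add: bernstein_op_def)
    have second: "(\<Sum>k\<le>N. Bernstein N k p * (real k / real N)\<^sup>2) = p\<^sup>2 + p * (1 - p) / real N"
      using bernstein_op_square[OF assms(1), of p] by (simp add: bernstein_op_def)
    have gap: "bernstein_op f N p \<le> f p"
      "f p - bernstein_op f N p \<le> d p * (p * (1 - p) / real N)"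
      using jensen_gap[of "{..N}" "\<lambda>k. Bernstein N k p" "\<lambda>k. real k / real N" p]
        assms p mean second by (auto simp: Bernstein_nonneg bernstein_op_def)
    \<comment> \<open>In the first alternative the variance p(1 - p)/N absorbs the growth of d near
      0. In the second, f p alone is below the rate and the Bernstein polynomial is
      nonnegative.\<close>
    from rate[OF assms(1) p assms(3)] have "f p - bernstein_op f N p \<le> r N"
    proof
      assume *: "p * d p \<le> real N * r N"
      have "d p * (p * (1 - p) / real N) = (p * d p) * (1 - p) / real N"
        by simp
      also have "\<dots> \<le> (real N * r N) * 1 / real N"
        using * assms p r_nonneg[of N]
        by (intro divide_right_mono mult_mono[OF *]) auto
      also have "\<dots> = r N"
        using assms by simp
      finally show ?thesis
        using gap by simp
    next
      assume "real N * p < 1 \<and> f p \<le> r N"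
      then show ?thesis
        using bernstein_op_nonneg[of p N] assms by simp
    qed
    with gap show ?thesis
      by simp
  qed
  then show "bernstein_op f N p \<le> f p" "f p - bernstein_op f N p \<le> r N"
    by auto
qed

text \<open>The gap of the two-point law left by deleting one observation, via
  \<open>jensen_gap\<close>. The bound keeps track of its vanishing at k = 0, since the lower bound
  on the bias needs an estimate linear in k.\<close>

lemma two_point_gap:
  fixes k m :: nat
  defines "x \<equiv> real k / real (Suc m)"
  defines "G \<equiv> real m * (f x - (x * f ((real k - 1) / real m) + (1 - x) * f (real k / real m)))"
  assumes "1 \<le> m" "k \<le> Suc m"
  shows "0 \<le> G" and "G \<le> 2 * (if k = 0 then 0 else r (Suc m))"
proof -
  have "0 \<le> G \<and> G \<le> 2 * (if k = 0 then 0 else r (Suc m))"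
  proof (cases "k = 0")
    case True
    then show ?thesis
      by (simp add: G_def x_def f_zero)
  next
    case False
    define a b where "a = (real k - 1) / real m" and "b = real k / real m"
    let ?N = "real (Suc m)"
    have x: "0 < x" "x \<le> 1"
      using False assms by (auto simp: x_def divide_le_eq_1)
    \<comment> \<open>At k = m + 1 the point \<open>b\<close> exceeds 1, with weight 0; the tangent
      bounds of the locale also cover such arguments.\<close>
    have ab: "0 \<le> a" "0 \<le> b"
      using False by (auto simp: a_def b_def)
    have k: "real k = x * (real m + 1)"
      by (simp add: x_def add.commute)
    have mean: "x * a + (1 - x) * b = x"
      using assms(3) unfolding a_def b_def k by (simp add: field_simps)
    have var: "x * a\<^sup>2 + (1 - x) * b\<^sup>2 - x\<^sup>2 = x * (1 - x) / (real m)\<^sup>2"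
      using assms(3) unfolding a_def b_def k by (simp add: field_simps power2_eq_square)
    have gap: "x * f a + (1 - x) * f b \<le> f x"
      "f x - (x * f a + (1 - x) * f b) \<le> d x * (x * (1 - x) / (real m)\<^sup>2)"
      using jensen_gap[of UNIV "\<lambda>t. if t then x else 1 - x" "\<lambda>t. if t then a else b" x]
        x ab mean var by (auto simp: UNIV_bool add.commute)
    \<comment> \<open>A positive fraction is at least 1/(m + 1), which excludes the second
      alternative of \<open>rate\<close>.\<close>
    have "1 \<le> ?N * x"
      using False by (simp add: x_def)
    then have xd: "x * d x \<le> ?N * r (Suc m)"
      using rate[of "Suc m" x] x by auto
    have "G \<le> real m * (d x * (x * (1 - x) / (real m)\<^sup>2))"
      unfolding G_def using gap(2) by (intro mult_left_mono) (auto simp: a_def b_def)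
    also have "\<dots> = (x * d x) * (1 - x) / real m"
      using assms(3) by (simp add: field_simps power2_eq_square)
    also have "\<dots> \<le> (?N * r (Suc m)) * 1 / real m"
      using x r_nonneg[of "Suc m"] by (intro divide_right_mono mult_mono[OF xd]) auto
    also have "\<dots> \<le> 2 * r (Suc m)"
    proof -
      \<comment> \<open>The factor 2 comes from (m + 1)/m \<le> 2.\<close>
      have "?N * r (Suc m) \<le> (2 * real m) * r (Suc m)"
        using assms(3) r_nonneg by (intro mult_right_mono) auto
      then show ?thesis
        using assms(3) by (simp add: pos_divide_le_eq mult_ac)
    qed
    finally show ?thesis
      using False gap(1) by (simp add: G_def a_def b_def)
  qed
  then show "0 \<le> G" "G \<le> 2 * (if k = 0 then 0 else r (Suc m))"
    by auto
qed

text \<open>The averaged two-point gap lies in [0, 2r] and the Bernstein error in [-r, 0]; the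
  opposite signs give 2r rather than 3r.\<close>

lemma abs_delete_one_bias_le:
  assumes "1 \<le> m" "0 \<le> p" "p \<le> 1"
  shows "\<bar>delete_one_bias f m p\<bar> \<le> 2 * r (Suc m)"
proof -
  let ?G = "\<lambda>k. real m * (f (real k / real (Suc m))
    - (real k / real (Suc m) * f ((real k - 1) / real m)
       + (1 - real k / real (Suc m)) * f (real k / real m)))"
  have G: "0 \<le> ?G k" "?G k \<le> 2 * r (Suc m)" if "k \<le> Suc m" for k
    using two_point_gap[OF assms(1) that] r_nonneg[of "Suc m"] by (auto split: if_splits)
  have "(\<Sum>k\<le>Suc m. Bernstein (Suc m) k p * ?G k) \<le> (\<Sum>k\<le>Suc m. Bernstein (Suc m) k p * (2 * r (Suc m)))"
    using assms G by (intro sum_mono mult_left_mono Bernstein_nonneg) auto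
  also have "\<dots> = 2 * r (Suc m)"
    by (simp only: sum_distrib_right[symmetric] sum_Bernstein)
  finally have "(\<Sum>k\<le>Suc m. Bernstein (Suc m) k p * ?G k) \<le> 2 * r (Suc m)" .
  moreover have "0 \<le> (\<Sum>k\<le>Suc m. Bernstein (Suc m) k p * ?G k)"
    using assms by (intro sum_nonneg mult_nonneg_nonneg[OF Bernstein_nonneg G(1)]) auto
  moreover have "bernstein_op f (Suc m) p \<le> f p" "f p - bernstein_op f (Suc m) p \<le> r (Suc m)"
    using bernstein_op_error[of "Suc m" p] assms by auto
  moreover note delete_one_bias_eq[OF assms(1), of f p] r_nonneg[of "Suc m"]
  ultimately show ?thesis
    by linarith
qed

text \<open>Every term vanishes at k = 0, and for k >= 1 the fraction is at least 1/n, where h is at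
  most h(1/n). Each term is thus at most a constant times k/(m + 1), whose mean is p. Using n in
  place of m + 1 makes the bound uniform in m.\<close>

lemma delete_one_bias_le:
  assumes "1 \<le> m" "Suc m \<le> n" "0 \<le> p" "p \<le> 1"
  shows "delete_one_bias f m p \<le> p * (h (1 / real n) + 2 * (real n * r n)) - f p"
proof -
  let ?N = "Suc m"
  let ?G = "\<lambda>k. real m * (f (real k / real ?N)
    - (real k / real ?N * f ((real k - 1) / real m)
       + (1 - real k / real ?N) * f (real k / real m)))"
  define B where "B = h (1 / real n) + 2 * (real ?N * r ?N)"
  have term_le: "?G k + f (real k / real ?N) \<le> real k / real ?N * B" if "k \<le> ?N" for k
  proof (cases "k = 0")
    case True
    then show ?thesis
      by (simp add: f_zero)
  next
    case False
    have "f (real k / real ?N) = real k / real ?N * h (real k / real ?N)"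
      using False by (intro f_eq) auto
    also have "\<dots> \<le> real k / real ?N * h (1 / real n)"
    proof (intro mult_left_mono h_antimono)
      have "1 / real n \<le> 1 / real ?N"
        using assms by (intro divide_left_mono) auto
      also have "\<dots> \<le> real k / real ?N"
        using False by (intro divide_right_mono) auto
      finally show "1 / real n \<le> real k / real ?N" .
    qed (use assms in auto)
    finally have 1: "f (real k / real ?N) \<le> real k / real ?N * h (1 / real n)" .
    have "?G k \<le> 2 * r ?N"
      using two_point_gap(2)[OF assms(1) that] False by simp
    \<comment> \<open>Since k >= 1, the constant bound may be replaced by one linear in k.\<close>
    also have "\<dots> \<le> real k * (2 * r ?N)"
      using False r_nonneg[of ?N] mult_right_mono[of 1 "real k" "2 * r ?N"] by simp
    also have "\<dots> = real k / real ?N * (2 * (real ?N * r ?N))"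
      by (simp del: of_nat_Suc)
    finally have "?G k \<le> real k / real ?N * (2 * (real ?N * r ?N))" .
    with 1 show ?thesis
      by (simp add: B_def distrib_left)
  qed
  have "delete_one_bias f m p + f p
      = (\<Sum>k\<le>?N. Bernstein ?N k p * ?G k) + (\<Sum>k\<le>?N. Bernstein ?N k p * f (real k / real ?N))"
    using delete_one_bias_eq[OF assms(1), of f p] unfolding bernstein_op_def by linarith
  also have "\<dots> = (\<Sum>k\<le>?N. Bernstein ?N k p * (?G k + f (real k / real ?N)))"
    by (simp only: sum.distrib distrib_left)
  also have "\<dots> \<le> (\<Sum>k\<le>?N. Bernstein ?N k p * (real k / real ?N * B))"
    using assms term_le by (intro sum_mono mult_left_mono Bernstein_nonneg) auto
  also have "\<dots> = bernstein_op (\<lambda>x. x) ?N p * B"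
    by (simp only: bernstein_op_def sum_distrib_right mult.assoc)
  also have "\<dots> = p * B"
    by (simp add: bernstein_op_ident)
  also have "\<dots> \<le> p * (h (1 / real n) + 2 * (real n * r n))"
    using scaled_r_mono[of ?N n] assms unfolding B_def by (intro mult_left_mono) auto
  finally show ?thesis
    by simp
qed

section \<open>From delete-1 biases to general 2-jackknives\<close>

lemma abs_jackknife2_bias_le:
  assumes "0 < n1" "n1 < n2" "n2 \<le> n" "p \<in> {0..1}"
  shows "\<bar>jackknife2_bias f n n1 n2 p\<bar> \<le> 2 * r n1"
proof -
  have "\<bar>\<Sum>m = n1..<n2. delete_one_bias f m p\<bar> \<le> (\<Sum>m = n1..<n2. \<bar>delete_one_bias f m p\<bar>)"
    by (rule sum_abs)
  also have "\<dots> \<le> (\<Sum>m = n1..<n2. 2 * r n1)"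
  proof (intro sum_mono)
    fix m assume m: "m \<in> {n1..<n2}"
    then show "\<bar>delete_one_bias f m p\<bar> \<le> 2 * r n1"
      using abs_delete_one_bias_le[of m p] r_antimono[of n1 "Suc m"] assms by auto
  qed
  also have "\<dots> = 2 * r n1 * (real n2 - real n1)"
    using assms by (simp add: of_nat_diff)
  finally show ?thesis
    using assms by (simp add: jackknife2_bias_eq pos_divide_le_eq abs_divide)
qed

lemma sup_norm_jackknife2_bias_le:
  assumes "0 < n1" "n1 < n2" "n2 \<le> n"
  shows "sup_norm (jackknife2_bias f n n1 n2) \<le> 2 * r n1"
  unfolding sup_norm_def by (intro cSUP_least abs_jackknife2_bias_le assms) auto

text \<open>At the common point \<epsilon>/n all delete-1 biases in the average are at most -
  \<epsilon> * r n, so no cancellation occurs.\<close>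

lemma sup_norm_jackknife2_bias_ge:
  assumes "0 < n1" "n1 < n2" "n2 \<le> n"
  shows "\<epsilon> * r n \<le> sup_norm (jackknife2_bias f n n1 n2)"
proof -
  define p where "p = \<epsilon> / real n"
  have n: "1 \<le> n"
    using assms by simp
  have p: "0 < p" "p \<le> 1"
    using eps n by (auto simp: p_def divide_le_eq_1)
  have each: "delete_one_bias f m p \<le> - (\<epsilon> * r n)" if "m \<in> {n1..<n2}" for m
  proof -
    have "delete_one_bias f m p \<le> p * (h (1 / real n) + 2 * (real n * r n)) - p * h p"
      using delete_one_bias_le[of m n p] that assms p f_eq[OF p(1)] by auto
    also have "\<dots> = p * (h (1 / real n) + 2 * (real n * r n) - h p)"
      by (simp add: algebra_simps)
    \<comment> \<open>Of the three units of n * r n in \<open>h_gap\<close>, two absorb the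
      two-point gaps and one remains.\<close>
    also have "\<dots> \<le> p * (- (real n * r n))"
      using h_gap[OF n] p unfolding p_def by (intro mult_left_mono) auto
    also have "\<dots> = - (\<epsilon> * r n)"
      using n by (simp add: p_def)
    finally show ?thesis .
  qed
  have "(\<Sum>m = n1..<n2. delete_one_bias f m p) \<le> (\<Sum>m = n1..<n2. - (\<epsilon> * r n))"
    by (intro sum_mono each)
  also have "\<dots> = - (\<epsilon> * r n) * (real n2 - real n1)"
    using assms by (simp add: of_nat_diff)
  finally have "jackknife2_bias f n n1 n2 p \<le> - (\<epsilon> * r n)"
    using assms p by (simp add: jackknife2_bias_eq pos_divide_le_eq)
  then have "\<epsilon> * r n \<le> \<bar>jackknife2_bias f n n1 n2 p\<bar>"
    by simp
  also have "\<dots> \<le> sup_norm (jackknife2_bias f n n1 n2)"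
    unfolding sup_norm_def
  proof (rule cSUP_upper)
    \<comment> \<open>The upper bound on the bias is what makes the real-valued supremum meaningful
      here.\<close>
    show "bdd_above ((\<lambda>p. \<bar>jackknife2_bias f n n1 n2 p\<bar>) ` {0..1})"
      using abs_jackknife2_bias_le[OF assms] by (intro bdd_aboveI2)
  qed (use p in auto)
  finally show ?thesis .
qed

end

section \<open>The two functions\<close>

text \<open>Here N * r N = 1 and x * d x = 1, so the first alternative of \<open>rate\<close> always
  holds. The gap condition asks - ln to grow by 3 from 1/N to \<epsilon>/N, whence \<epsilon> = exp
  (- 3). Both tangent bounds come from ln t \<le> t - 1.\<close>

interpretation entropy: concave_profile neg_p_ln_p "\<lambda>x. - ln x" "\<lambda>x. - ln x - 1" "\<lambda>x. 1 / x"
  "\<lambda>n. 1 / real n" "exp (- 3)"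
proof
  fix \<mu> x :: real
  assume \<mu>: "0 < \<mu>"
  have ln_le: "ln (s / t) \<le> s / t - 1" if "0 < s" "0 < t" for s t :: real
    using that by (intro ln_le_minus_one) simp
  show "neg_p_ln_p x \<le> neg_p_ln_p \<mu> + (- ln \<mu> - 1) * (x - \<mu>)" if "0 \<le> x"
  proof (cases "x = 0")
    case False
    with that have x: "0 < x"
      by simp
    have "x * ln (\<mu> / x) \<le> x * (\<mu> / x - 1)"
      using ln_le[OF \<mu> x] x by (intro mult_left_mono) auto
    also have "\<dots> = \<mu> - x"
      using x by (simp add: field_simps)
    finally show ?thesis
      using x \<mu> by (simp add: neg_p_ln_p_def ln_div algebra_simps)
  qed (use \<mu> in \<open>simp add: neg_p_ln_p_def algebra_simps\<close>)
  show "- ln \<mu> - 1 / \<mu> * (x - \<mu>) \<le> - ln x" if "0 < x"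
    using ln_le[OF that \<mu>] that \<mu> by (simp add: ln_div field_simps)
qed (auto simp: neg_p_ln_p_def ln_div frac_le)

text \<open>The value of \<epsilon> solves \<epsilon> powr (\<alpha> - 1) = 4. As h(1/N) and N * r N
  both equal N powr (1 - \<alpha>), this makes \<open>h_gap\<close> an equality.\<close>

lemma powr_concave_profile:
  fixes \<alpha> :: real
  assumes "0 < \<alpha>" "\<alpha> < 1"
  shows "concave_profile (\<lambda>x. x powr \<alpha>) (\<lambda>x. x powr (\<alpha> - 1)) (\<lambda>x. \<alpha> * x powr (\<alpha> - 1))
    (\<lambda>x. (1 - \<alpha>) * x powr (\<alpha> - 2)) (\<lambda>n. 1 / real n powr \<alpha>) (4 powr (- 1 / (1 - \<alpha>)))"
proof
  have scaled: "real N * (1 / real N powr \<alpha>) = real N powr (1 - \<alpha>)" for N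
    by (cases "N = 0") (auto simp: powr_diff)
  fix \<mu> x :: real and m N :: nat
  show "x powr \<alpha> = x * x powr (\<alpha> - 1)" if "0 < x"
    using that by (simp add: powr_diff)
  show "x powr \<alpha> \<le> \<mu> powr \<alpha> + \<alpha> * \<mu> powr (\<alpha> - 1) * (x - \<mu>)" if "0 < \<mu>" "0 \<le> x"
  proof (cases "x = 0")
    case True
    have "\<alpha> * \<mu> powr \<alpha> \<le> \<mu> powr \<alpha>"
      using assms by (simp add: mult_left_le_one_le)
    with True that show ?thesis
      by (simp add: powr_diff)
  next
    case False
    \<comment> \<open>Weighted AM-GM with weights \<alpha> and 1 - \<alpha>; dividing by \<mu> powr
      (1 - \<alpha>) gives the tangent bound.\<close>
    with that have "x powr \<alpha> * \<mu> powr (1 - \<alpha>) \<le> \<alpha> * x + (1 - \<alpha>) * \<mu>"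
      using assms by (intro Youngs_inequality_0) auto
    then have "x powr \<alpha> * \<mu> powr (1 - \<alpha>) * \<mu> powr (\<alpha> - 1) \<le> (\<alpha> * x + (1 - \<alpha>) * \<mu>) * \<mu> powr (\<alpha> - 1)"
      by (intro mult_right_mono) auto
    with that show ?thesis
      by (simp add: powr_diff field_simps)
  qed
  show "\<mu> powr (\<alpha> - 1) - (1 - \<alpha>) * \<mu> powr (\<alpha> - 2) * (x - \<mu>) \<le> x powr (\<alpha> - 1)" if "0 < \<mu>" "0 < x"
  proof -
    \<comment> \<open>The tangent of the convex power, rescaled to the ratio x/\<mu>, follows from
      ln t \<le> t - 1 and exp s >= 1 + s.\<close>
    have "(1 - \<alpha>) * ln (x / \<mu>) \<le> (1 - \<alpha>) * (x / \<mu> - 1)"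
      using assms that by (intro mult_left_mono ln_le_minus_one) auto
    then have "1 - (1 - \<alpha>) * (x / \<mu> - 1) \<le> 1 + (\<alpha> - 1) * ln (x / \<mu>)"
      by (simp add: algebra_simps)
    also have "\<dots> \<le> (x / \<mu>) powr (\<alpha> - 1)"
      using that by (simp add: powr_def exp_ge_add_one_self)
    finally have "\<mu> powr (\<alpha> - 1) * (1 - (1 - \<alpha>) * (x / \<mu> - 1)) \<le> \<mu> powr (\<alpha> - 1) * (x / \<mu>) powr (\<alpha> - 1)"
      by (intro mult_left_mono) auto
    also have "\<dots> = x powr (\<alpha> - 1)"
      using that by (simp add: powr_divide)
    also have "\<mu> powr (\<alpha> - 1) * (1 - (1 - \<alpha>) * (x / \<mu> - 1))
        = \<mu> powr (\<alpha> - 1) - (1 - \<alpha>) * \<mu> powr (\<alpha> - 2) * (x - \<mu>)"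
      using that by (simp add: powr_diff field_simps power2_eq_square)
    finally show ?thesis .
  qed
  show "1 / real N powr \<alpha> \<le> 1 / real m powr \<alpha>" if "1 \<le> m" "m \<le> N"
    using that assms by (intro divide_left_mono powr_mono2) auto
  show "real m * (1 / real m powr \<alpha>) \<le> real N * (1 / real N powr \<alpha>)" if "1 \<le> m" "m \<le> N"
    unfolding scaled using that assms by (intro powr_mono2) auto
  show "x * ((1 - \<alpha>) * x powr (\<alpha> - 2)) \<le> real N * (1 / real N powr \<alpha>)
      \<or> real N * x < 1 \<and> x powr \<alpha> \<le> 1 / real N powr \<alpha>" if "1 \<le> N" "0 < x" "x \<le> 1"
  \<comment> \<open>Below 1/N the function itself is at most the rate; above it, x powr (\<alpha> -
    1) is at most N powr (1 - \<alpha>).\<close>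
  proof (cases "real N * x < 1")
    case True
    with that have "x powr \<alpha> \<le> (1 / real N) powr \<alpha>"
      using assms by (intro powr_mono2) (auto simp: field_simps)
    with True show ?thesis
      using that by (simp add: powr_divide)
  next
    case False
    have "x * ((1 - \<alpha>) * x powr (\<alpha> - 2)) = (1 - \<alpha>) * x powr (\<alpha> - 1)"
      using that by (simp add: powr_diff power2_eq_square)
    also have "\<dots> \<le> 1 * (1 / x) powr (1 - \<alpha>)"
      using assms that by (intro mult_mono) (auto simp: powr_divide powr_diff)
    also have "\<dots> \<le> 1 * real N powr (1 - \<alpha>)"
      using False that assms by (intro mult_left_mono powr_mono2) (auto simp: field_simps)
    finally show ?thesis
      unfolding scaled by simp
  qed
  show "(1 / real N) powr (\<alpha> - 1) + 3 * (real N * (1 / real N powr \<alpha>))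
      \<le> (4 powr (- 1 / (1 - \<alpha>)) / real N) powr (\<alpha> - 1)" if "1 \<le> N"
  proof -
    have "(\<alpha> - 1) * (- 1 / (1 - \<alpha>)) = 1"
      using assms by (simp add: field_simps)
    then have four: "(4 powr (- 1 / (1 - \<alpha>))) powr (\<alpha> - 1) = (4 :: real)"
      by (simp add: powr_powr mult.commute)
    have inv: "(1 / real N) powr (\<alpha> - 1) = real N powr (1 - \<alpha>)"
      using that by (simp add: powr_divide powr_diff)
    have split: "(4 powr (- 1 / (1 - \<alpha>)) / real N) powr (\<alpha> - 1)
        = (4 powr (- 1 / (1 - \<alpha>))) powr (\<alpha> - 1) * (1 / real N) powr (\<alpha> - 1)"
      by (simp flip: powr_mult)
    show ?thesis
      unfolding scaled split four inv by simp
  qed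
  show "4 powr (- 1 / (1 - \<alpha>)) \<le> (1 :: real)"
    using assms powr_mono[of "- 1 / (1 - \<alpha>)" 0 4] by simp
qed (use assms in auto)

section \<open>Upper and lower bounds for both functions\<close>

lemma estimator_sizes:
  assumes "delete_one n n1 n2 \<or> (admissible K n n1 n2 \<and> bounded_coeffs C n1 n2)"
  shows "0 < n1" "n1 < n2" "n2 \<le> n"
  using assms by (auto simp: delete_one_def admissible_def)

theorem theorem6:
  fixes K C :: real
  assumes "K > 0"
  shows
    "(\<exists>M>0. \<forall>n n1 n2. admissible K n n1 n2 \<longrightarrow>
        sup_norm (jackknife2_bias neg_p_ln_p n n1 n2) \<le> M * (1 / real n)) \<and>
     (\<forall>\<alpha>. 0 < \<alpha> \<and> \<alpha> < 1 \<longrightarrow>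
       (\<exists>M>0. \<forall>n n1 n2. admissible K n n1 n2 \<longrightarrow>
          sup_norm (jackknife2_bias (\<lambda>p. p powr \<alpha>) n n1 n2) \<le> M * (1 / real n powr \<alpha>))) \<and>
     (\<exists>M>0. \<forall>n n1 n2.
        delete_one n n1 n2 \<or> (admissible K n n1 n2 \<and> bounded_coeffs C n1 n2) \<longrightarrow>
        1 / real n \<le> M * sup_norm (jackknife2_bias neg_p_ln_p n n1 n2)) \<and>
     (\<forall>\<alpha>. 0 < \<alpha> \<and> \<alpha> < 1 \<longrightarrow>
       (\<exists>M>0. \<forall>n n1 n2.
          delete_one n n1 n2 \<or> (admissible K n n1 n2 \<and> bounded_coeffs C n1 n2) \<longrightarrow>
          1 / real n powr \<alpha> \<le> M * sup_norm (jackknife2_bias (\<lambda>p. p powr \<alpha>) n n1 n2)))"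
proof (intro conjI allI impI)
  show "\<exists>M>0. \<forall>n n1 n2. admissible K n n1 n2 \<longrightarrow>
      sup_norm (jackknife2_bias neg_p_ln_p n n1 n2) \<le> M * (1 / real n)"
  \<comment> \<open>The factor K converts the rate at n1 into the rate at n, by n \<le> K *
    n1.\<close>
  proof (intro exI[of _ "2 * K"] conjI allI impI)
    fix n n1 n2 assume "admissible K n n1 n2"
    then have adm: "0 < n1" "n1 < n2" "n2 \<le> n" "real n \<le> K * real n1"
      by (auto simp: admissible_def)
    have "sup_norm (jackknife2_bias neg_p_ln_p n n1 n2) \<le> 2 * (1 / real n1)"
      by (rule entropy.sup_norm_jackknife2_bias_le[OF adm(1-3)])
    also have "\<dots> \<le> 2 * K * (1 / real n)"
      using adm by (simp add: field_simps)
    finally show "sup_norm (jackknife2_bias neg_p_ln_p n n1 n2) \<le> 2 * K * (1 / real n)" .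
  qed (use assms in simp)
  show "\<exists>M>0. \<forall>n n1 n2.
      delete_one n n1 n2 \<or> (admissible K n n1 n2 \<and> bounded_coeffs C n1 n2) \<longrightarrow>
      1 / real n \<le> M * sup_norm (jackknife2_bias neg_p_ln_p n n1 n2)"
  \<comment> \<open>The constant is 1/\<epsilon> for the \<epsilon> of the interpretation.\<close>
  proof (intro exI[of _ "1 / exp (- 3)"] conjI allI impI)
    fix n n1 n2
    assume "delete_one n n1 n2 \<or> (admissible K n n1 n2 \<and> bounded_coeffs C n1 n2)"
    from entropy.sup_norm_jackknife2_bias_ge[OF estimator_sizes[OF this]]
    show "1 / real n \<le> 1 / exp (- 3) * sup_norm (jackknife2_bias neg_p_ln_p n n1 n2)"
      by (simp add: pos_le_divide_eq mult.commute)
  qed simp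
next
  fix \<alpha> :: real
  assume "0 < \<alpha> \<and> \<alpha> < 1"
  then have \<alpha>: "0 < \<alpha>" "\<alpha> < 1"
    by auto
  show "\<exists>M>0. \<forall>n n1 n2. admissible K n n1 n2 \<longrightarrow>
      sup_norm (jackknife2_bias (\<lambda>p. p powr \<alpha>) n n1 n2) \<le> M * (1 / real n powr \<alpha>)"
  proof (intro exI[of _ "2 * K powr \<alpha>"] conjI allI impI)
    fix n n1 n2 assume "admissible K n n1 n2"
    then have adm: "0 < n1" "n1 < n2" "n2 \<le> n" "real n \<le> K * real n1"
      by (auto simp: admissible_def)
    have "real n powr \<alpha> \<le> (K * real n1) powr \<alpha>"
      using adm \<alpha> by (intro powr_mono2) auto
    then have "real n powr \<alpha> \<le> K powr \<alpha> * real n1 powr \<alpha>"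
      using assms by (simp add: powr_mult)
    then have "1 / real n1 powr \<alpha> \<le> K powr \<alpha> * (1 / real n powr \<alpha>)"
      using adm by (simp add: field_simps)
    then show "sup_norm (jackknife2_bias (\<lambda>p. p powr \<alpha>) n n1 n2) \<le> 2 * K powr \<alpha> * (1 / real n powr \<alpha>)"
      using concave_profile.sup_norm_jackknife2_bias_le[OF powr_concave_profile[OF \<alpha>] adm(1-3)]
      by simp
  qed (use assms in simp)
  show "\<exists>M>0. \<forall>n n1 n2.
      delete_one n n1 n2 \<or> (admissible K n n1 n2 \<and> bounded_coeffs C n1 n2) \<longrightarrow>
      1 / real n powr \<alpha> \<le> M * sup_norm (jackknife2_bias (\<lambda>p. p powr \<alpha>) n n1 n2)"
  proof (intro exI[of _ "1 / 4 powr (- 1 / (1 - \<alpha>))"] conjI allI impI)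
    fix n n1 n2
    assume "delete_one n n1 n2 \<or> (admissible K n n1 n2 \<and> bounded_coeffs C n1 n2)"
    from concave_profile.sup_norm_jackknife2_bias_ge[OF powr_concave_profile[OF \<alpha>]
        estimator_sizes[OF this]]
    show "1 / real n powr \<alpha>
        \<le> 1 / 4 powr (- 1 / (1 - \<alpha>)) * sup_norm (jackknife2_bias (\<lambda>p. p powr \<alpha>) n n1 n2)"
      by (simp add: pos_le_divide_eq mult.commute)
  qed simp
qed

end
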